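(* Let $\mathbb{H}$ be the three-dimensional Heisenberg group and let $q \in \mathbb{H}$. If $\lambda_0 \in \mathscr{A}_q \setminus H_q^{-1}(0)$ is a conjugate vector, i.e. $\mathrm{Ker}(d_{\lambda_0}\exp_q) \neq \{0\}$, then the sub-Riemannian exponential map $\exp_q : \mathscr{A}_q \to \mathbb{H}$ is not injective on any neighbourhood of $\lambda_0$.
   Context: The Heisenberg group $\mathbb{H}$ is the sub-Riemannian structure on $\mathbb{R}^3$ (coordinates $(x,y,\tau)$) generated by the global vector fields $X_1 = \partial_x - \frac{y}{2}\partial_\tau$, $X_2 = \partial_y + \frac{x}{2}\partial_\tau$. Its Hamiltonian is $H : T^*(\mathbb{H}) \to \mathbb{R}$, $H(\lambda) = \frac12\left(\langle\lambda,X_1\rangle^2 + \langle\lambda,X_2\rangle^2\right) = \frac12\left((u - \frac{\alpha y}{2})^2 + (v + \frac{\alpha x}{2})^2\right)$ for $\lambda = u\,dx|_q + v\,dy|_q + \alpha\,d\tau|_q$, $q=(x,y,\tau)$; $H_q$ is its restriction to $T_q^*(\mathbb{H})$. With $\omega$ the canonical symplectic form on the cotangent bundle, $\vec H$ is the Hamiltonian vector field defined by $\omega(\cdot,\vec H(\lambda)) = d_\lambda H$, with flow $e^{t\vec H}$, and $\pi : T^*(\mathbb{H}) \to \mathbb{H}$ is the projection. $\mathscr{A}_q \subseteq T_q^*(\mathbb{H})$ is the open set of covectors whose integral curve of $\vec H$ is defined on $[0,1]$, and $\exp_q(\lambda_0) = \pi(e^{\vec H}(\lambda_0))$. *)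

theory Defs
  imports "HOL-Analysis.Analysis"
begin

text \<open>
  The Heisenberg group in its global coordinates \<open>(x, y, \<tau>)\<close>. A tangent vector
  \<open>a \<partial>\<^sub>x + b \<partial>\<^sub>y + c \<partial>\<^sub>\<tau>\<close> at a point is represented by \<open>(a, b, c)\<close>, and a
  covector \<open>u dx + v dy + \<alpha> d\<tau>\<close> by \<open>(u, v, \<alpha>)\<close>, so that the duality pairing is the
  inner product of the coordinate triples. The cotangent bundle is trivialised as the
  set of pairs (base point, covector).
\<close>

type_synonym heis = "real \<times> real \<times> real"
type_synonym covec = "real \<times> real \<times> real"
type_synonym cotangent = "heis \<times> covec"

definition X1 :: "heis \<Rightarrow> real \<times> real \<times> real" where
  "X1 = (\<lambda>(x, y, \<tau>). (1, 0, - y / 2))"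

definition X2 :: "heis \<Rightarrow> real \<times> real \<times> real" where
  "X2 = (\<lambda>(x, y, \<tau>). (0, 1, x / 2))"

definition hamiltonian :: "cotangent \<Rightarrow> real" where
  "hamiltonian = (\<lambda>(q, p). ((p \<bullet> X1 q)\<^sup>2 + (p \<bullet> X2 q)\<^sup>2) / 2)"

definition hamiltonian_at :: "heis \<Rightarrow> covec \<Rightarrow> real" where
  "hamiltonian_at q p = hamiltonian (q, p)"

lemma hamiltonian_coords:
  "hamiltonian ((x, y, \<tau>), (u, v, \<alpha>)) = ((u - \<alpha> * y / 2)\<^sup>2 + (v + \<alpha> * x / 2)\<^sup>2) / 2"
  by (simp add: hamiltonian_def X1_def X2_def)

text \<open>
  The sign convention for the canonical symplectic form is \<open>\<Sum>\<^sub>i dp\<^sub>i \<and> dq\<^sub>i\<close>, the exterior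
  derivative of the Liouville form \<open>\<Sum>\<^sub>i p\<^sub>i dq\<^sub>i\<close>; with \<open>\<omega>(\<cdot>, w) = dh\<close> it gives Hamilton's
  equations \<open>q' = \<partial>h/\<partial>p\<close>, \<open>p' = - \<partial>h/\<partial>q\<close>.
\<close>

definition symplectic_form :: "cotangent \<Rightarrow> cotangent \<Rightarrow> real" where
  "symplectic_form v w = snd v \<bullet> fst w - fst v \<bullet> snd w"

definition hamiltonian_vector_field :: "(cotangent \<Rightarrow> real) \<Rightarrow> cotangent \<Rightarrow> cotangent" where
  "hamiltonian_vector_field h z =
     (THE w. \<forall>v. symplectic_form v w = frechet_derivative h (at z) v)"

definition integral_curve_on ::
    "('a::real_normed_vector \<Rightarrow> 'a) \<Rightarrow> real set \<Rightarrow> (real \<Rightarrow> 'a) \<Rightarrow> bool" where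
  "integral_curve_on V I \<gamma> \<longleftrightarrow> (\<forall>t\<in>I. (\<gamma> has_vector_derivative V (\<gamma> t)) (at t within I))"

text \<open>
  \<open>flow V t z\<close> is only meaningful when the integral curve of \<open>V\<close> starting at \<open>z\<close> exists
  (and is unique) up to time \<open>t\<close>.
\<close>

definition flow :: "('a::real_normed_vector \<Rightarrow> 'a) \<Rightarrow> real \<Rightarrow> 'a \<Rightarrow> 'a" where
  "flow V t z =
     (THE w. \<exists>\<gamma>. integral_curve_on V (closed_segment 0 t) \<gamma> \<and> \<gamma> 0 = z \<and> \<gamma> t = w)"

definition exp_domain :: "heis \<Rightarrow> covec set" where
  "exp_domain q =
     {p. \<exists>\<gamma>. integral_curve_on (hamiltonian_vector_field hamiltonian) {0..1} \<gamma> \<and> \<gamma> 0 = (q, p)}"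

definition sR_exp :: "heis \<Rightarrow> covec \<Rightarrow> heis" where
  "sR_exp q p = fst (flow (hamiltonian_vector_field hamiltonian) 1 (q, p))"

text \<open>
  \<open>frechet_derivative\<close> is the genuine differential here only because \<open>sR_exp q\<close> is smooth on
  the open set \<open>exp_domain q\<close>.
\<close>

definition conjugate_vector :: "heis \<Rightarrow> covec \<Rightarrow> bool" where
  "conjugate_vector q p \<longleftrightarrow> {v. frechet_derivative (sR_exp q) (at p) v = 0} \<noteq> {0}"

end

theory Submission
  imports Defs "HOL-Real_Asymp.Real_Asymp"
begin

text \<open>
  Left translations reduce everything to the identity element. There a covector is a pair
  \<open>(w, \<alpha>)\<close> of a complex number and a real number. Its Hamiltonian curve projects to the circular
  arc in the plane with initial velocity \<open>w\<close> and angular velocity \<open>\<alpha>\<close>, and lifts it by the area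
  that the arc sweeps out. So the exponential map is
  \<open>(w, \<alpha>) \<mapsto> (w * chord \<alpha>, (norm w)\<^sup>2 * area \<alpha>)\<close>, where \<open>chord\<close> and \<open>area\<close> describe the arc with \<open>w = 1\<close>
  (\<open>hamiltonian_curve_endpoint\<close>, \<open>sR_exp_eq_std_exp\<close>).

  Suppose that \<open>w \<noteq> 0\<close> and that the differential of this map has a kernel. There are two ways in which this
  can happen, and each produces nearby covectors with the same image.

  If \<open>chord \<alpha> = 0\<close>, the arc runs through whole circles, and rotating \<open>w\<close> changes neither the
  endpoint nor the area (\<open>std_exp_not_inj_if_chord_0\<close>).

  If \<open>chord \<alpha> \<noteq> 0\<close>, the kernel condition says that the scale-invariant ratio
  \<open>area / (norm chord)\<^sup>2\<close> has derivative zero at \<open>\<alpha>\<close>, and \<open>\<alpha> = 0\<close> is excluded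
  (\<open>critical_std_exp_imp_critical_area_ratio\<close>). All such critical points are nondegenerate, so the
  ratio has a strict local extremum there and takes equal values at two parameters arbitrarily close to \<open>\<alpha>\<close>
  (\<open>area_ratio_not_inj_near_critical_point\<close>). Adjusting \<open>w\<close> so that the chords coincide
  makes the areas coincide as well (\<open>std_exp_not_inj_if_critical_area_ratio\<close>).
\<close>

section \<open>Simple critical points\<close>

text \<open>
  The derivative changes sign at a simple zero, whereas an injective continuous function on an
  interval is monotone, so that its derivative has a constant sign.
\<close>
lemma not_inj_near_simple_critical_point:
  fixes f f' :: "real \<Rightarrow> real"
  assumes e: "e > 0"
    and deriv: "\<And>x. \<bar>x - c\<bar> < e \<Longrightarrow> (f has_real_derivative f' x) (at x)"
    and deriv2: "(f' has_real_derivative D) (at c)"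
    and crit: "f' c = 0" and simple: "D \<noteq> 0"
  shows "\<not> inj_on f {c - e<..<c + e}"
proof
  assume inj: "inj_on f {c - e<..<c + e}"
  let ?S = "{c - e<..<c + e}"
  obtain x1 x2 where x: "x1 \<in> ?S" "x2 \<in> ?S" and sgn: "f' x1 < 0" "0 < f' x2"
  proof (cases "D > 0")
    case True
    obtain d where d: "d > 0" "\<And>h. 0 < h \<Longrightarrow> h < d \<Longrightarrow> f' c < f' (c + h)"
      using DERIV_pos_inc_right[OF deriv2 True] by auto
    obtain d' where d': "d' > 0" "\<And>h. 0 < h \<Longrightarrow> h < d' \<Longrightarrow> f' (c - h) < f' c"
      using DERIV_pos_inc_left[OF deriv2 True] by auto
    define h where "h = min e (min d d') / 2"
    have h: "0 < h" "h < e" "h < d" "h < d'" using e d(1) d'(1) by (auto simp: h_def)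
    show thesis using h d(2)[of h] d'(2)[of h] crit by (intro that[of "c - h" "c + h"]) auto
  next
    case False
    then have neg: "D < 0" using simple by simp
    obtain d where d: "d > 0" "\<And>h. 0 < h \<Longrightarrow> h < d \<Longrightarrow> f' c > f' (c + h)"
      using DERIV_neg_dec_right[OF deriv2 neg] by auto
    obtain d' where d': "d' > 0" "\<And>h. 0 < h \<Longrightarrow> h < d' \<Longrightarrow> f' (c - h) > f' c"
      using DERIV_neg_dec_left[OF deriv2 neg] by auto
    define h where "h = min e (min d d') / 2"
    have h: "0 < h" "h < e" "h < d" "h < d'" using e d(1) d'(1) by (auto simp: h_def)
    show thesis using h d(2)[of h] d'(2)[of h] crit by (intro that[of "c + h" "c - h"]) auto
  qed
  have derivS: "(f has_real_derivative f' x) (at x)" if "x \<in> ?S" for x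
    using that by (intro deriv) auto
  have "continuous_on ?S f"
    using derivS DERIV_isCont by (blast intro: continuous_at_imp_continuous_on)
  then have "strict_mono_on ?S f \<or> strict_antimono_on ?S f"
    using inj injective_eq_monotone_map[of ?S f] is_interval_oo by blast
  then show False
  proof
    assume "strict_mono_on ?S f"
    then have "mono_on ?S f" by (rule strict_mono_on_imp_mono_on)
    then show False
      using mono_on_imp_deriv_nonneg[OF _ derivS[OF x(1)], of ?S] x(1) sgn(1)
      by (simp add: interior_open)
  next
    assume "strict_antimono_on ?S f"
    then have "mono_on ?S (\<lambda>x. - f x)"
      by (force simp: monotone_on_def le_less)
    moreover have "((\<lambda>x. - f x) has_real_derivative - f' x2) (at x2)"
      by (intro derivative_intros derivS x)
    ultimately show False
      using mono_on_imp_deriv_nonneg[of ?S "\<lambda>x. - f x" "- f' x2" x2] x(2) sgn(2)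
      by (simp add: interior_open)
  qed
qed

section \<open>Chord and area of a circular arc\<close>

text \<open>
  Follow for unit time the unit-speed plane curve of constant curvature \<open>\<alpha>\<close> that starts in the
  direction \<open>1\<close>. Its displacement is \<open>chord \<alpha> = \<integral> exp (\<i> \<alpha> t) dt\<close>, and the signed area between
  this circular arc and its chord is \<open>area \<alpha>\<close>. Both integrals are analytic in \<open>\<alpha>\<close>; the values at
  \<open>0\<close> fill the removable singularities of the closed forms.
\<close>
definition chord :: "real \<Rightarrow> complex" where
  "chord \<alpha> = (if \<alpha> = 0 then 1 else (cis \<alpha> - 1) / (\<i> * \<alpha>))"

definition area :: "real \<Rightarrow> real" where
  "area \<alpha> = (if \<alpha> = 0 then 0 else (\<alpha> - sin \<alpha>) / (2 * \<alpha>\<^sup>2))"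

lemma chord_coords:
  "\<alpha> \<noteq> 0 \<Longrightarrow> chord \<alpha> = Complex (sin \<alpha> / \<alpha>) ((1 - cos \<alpha>) / \<alpha>)"
  by (simp add: chord_def complex_eq_iff Re_divide Im_divide power2_eq_square field_simps)

lemma chord_eq_0_iff: "chord \<alpha> = 0 \<longleftrightarrow> \<alpha> \<noteq> 0 \<and> cos \<alpha> = 1"
proof -
  have "sin \<alpha> = 0" if "cos \<alpha> = 1" using that sin_cos_squared_add[of \<alpha>] by simp
  then show ?thesis
    by (cases "\<alpha> = 0") (auto simp: chord_def[of 0] chord_coords complex_eq_iff)
qed

lemma norm_chord_squared:
  assumes "\<alpha> \<noteq> 0" shows "(norm (chord \<alpha>))\<^sup>2 = 2 * (1 - cos \<alpha>) / \<alpha>\<^sup>2"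
proof -
  have "(norm (chord \<alpha>))\<^sup>2 = ((sin \<alpha>)\<^sup>2 + (1 - cos \<alpha>)\<^sup>2) / \<alpha>\<^sup>2"
    using assms by (simp add: chord_coords cmod_power2 power_divide add_divide_distrib)
  also have "(sin \<alpha>)\<^sup>2 + (1 - cos \<alpha>)\<^sup>2 = 2 * (1 - cos \<alpha>)"
    using sin_cos_squared_add[of \<alpha>] by (simp add: power2_eq_square algebra_simps)
  finally show ?thesis .
qed

lemma area_deriv_0: "(area has_real_derivative 1/12) (at 0)"
proof -
  have "((\<lambda>h::real. (h - sin h) / (2 * h\<^sup>2) / h) \<longlongrightarrow> 1/12) (at 0)" by real_asymp
  then have "((\<lambda>h. (area (0 + h) - area 0) / h) \<longlongrightarrow> 1/12) (at 0)"
    by (rule Lim_transform_eventually)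
       (auto simp: area_def eventually_at_filter)
  then show ?thesis by (simp add: DERIV_def)
qed

lemma area_differentiable: "\<exists>D. (area has_real_derivative D) (at \<alpha>)"
proof (cases "\<alpha> = 0")
  case False
  have "\<exists>D. ((\<lambda>\<alpha>. (\<alpha> - sin \<alpha>) / (2 * \<alpha>\<^sup>2)) has_real_derivative D) (at \<alpha>)"
    using False by (intro exI) (rule derivative_eq_intros refl | simp)+
  moreover have "\<forall>\<^sub>F x in nhds \<alpha>. (x - sin x) / (2 * x\<^sup>2) = area x"
    using t1_space_nhds[OF False] by (rule eventually_mono) (simp add: area_def)
  ultimately show ?thesis
    using DERIV_cong_ev[OF refl _ refl] by metis
qed (use area_deriv_0 in auto)

lemma chord_differentiable: "\<exists>c. (chord has_vector_derivative c) (at \<alpha>)"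
proof (cases "\<alpha> = 0")
  case True
  have "((\<lambda>h::real. (sin h / h - 1) / h) \<longlongrightarrow> 0) (at 0)" by real_asymp
  then have "((\<lambda>h. (Re (chord (0 + h)) - Re (chord 0)) / h) \<longlongrightarrow> 0) (at 0)"
    by (rule Lim_transform_eventually)
       (auto simp: chord_coords chord_def[of 0] eventually_at_filter)
  moreover have "((\<lambda>h::real. (1 - cos h) / h / h) \<longlongrightarrow> 1/2) (at 0)" by real_asymp
  then have "((\<lambda>h. (Im (chord (0 + h)) - Im (chord 0)) / h) \<longlongrightarrow> 1/2) (at 0)"
    by (rule Lim_transform_eventually)
       (auto simp: chord_coords chord_def[of 0] eventually_at_filter)
  ultimately have "(chord has_vector_derivative Complex 0 (1/2)) (at 0)"
    by (simp add: has_vector_derivative_complex_iff DERIV_def)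
  then show ?thesis using True by blast
next
  case False
  have "\<exists>D. ((\<lambda>\<alpha>. sin \<alpha> / \<alpha>) has_real_derivative D) (at \<alpha>)"
    using False by (intro exI) (rule derivative_eq_intros refl | simp)+
  moreover have "\<exists>D. ((\<lambda>\<alpha>. (1 - cos \<alpha>) / \<alpha>) has_real_derivative D) (at \<alpha>)"
    using False by (intro exI) (rule derivative_eq_intros refl | simp)+
  ultimately obtain D1 D2 where "((\<lambda>\<alpha>. sin \<alpha> / \<alpha>) has_real_derivative D1) (at \<alpha>)"
    "((\<lambda>\<alpha>. (1 - cos \<alpha>) / \<alpha>) has_real_derivative D2) (at \<alpha>)" by auto
  then have "((\<lambda>\<alpha>. Complex (sin \<alpha> / \<alpha>) ((1 - cos \<alpha>) / \<alpha>)) has_vector_derivative Complex D1 D2) (at \<alpha>)"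
    by (simp add: has_vector_derivative_complex_iff)
  then have "(chord has_vector_derivative Complex D1 D2) (at \<alpha>)"
    by (rule has_vector_derivative_transform_within_open[where S = "- {0}"])
       (use False in \<open>auto simp: chord_coords\<close>)
  then show ?thesis by blast
qed

text \<open>
  This ratio is invariant under rescaling the arc. Away from zeros of \<open>chord\<close>, arcs of different
  curvature can therefore be rotated and scaled to end at the same point with the same enclosed
  area exactly when their ratios agree.
\<close>
definition area_ratio :: "real \<Rightarrow> real" where
  "area_ratio \<alpha> = area \<alpha> / (norm (chord \<alpha>))\<^sup>2"

lemma area_ratio_deriv:
  assumes "chord \<alpha> \<noteq> 0" "\<alpha> \<noteq> 0"
  shows "(area_ratio has_real_derivative
           (2 * (1 - cos \<alpha>) - \<alpha> * sin \<alpha>) / (4 * (1 - cos \<alpha>)\<^sup>2)) (at \<alpha>)"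
proof -
  have c: "cos \<alpha> \<noteq> 1" using assms by (simp add: chord_eq_0_iff)
  have cancel: "4 * k / (4 * d)\<^sup>2 = k / (4 * d\<^sup>2)" for k d :: real
    by (simp add: power2_eq_square)
  have "((\<lambda>\<alpha>. (\<alpha> - sin \<alpha>) / (4 * (1 - cos \<alpha>))) has_real_derivative
      ((1 - cos \<alpha>) * (4 * (1 - cos \<alpha>)) - (\<alpha> - sin \<alpha>) * (4 * sin \<alpha>)) / (4 * (1 - cos \<alpha>))\<^sup>2) (at \<alpha>)"
    using c by (auto intro!: derivative_eq_intros simp: power2_eq_square)
  also have "(1 - cos \<alpha>) * (4 * (1 - cos \<alpha>)) - (\<alpha> - sin \<alpha>) * (4 * sin \<alpha>)
      = 4 * (2 * (1 - cos \<alpha>) - \<alpha> * sin \<alpha>)"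
    using sin_cos_squared_add[of \<alpha>] unfolding power2_eq_square by algebra
  also have "4 * (2 * (1 - cos \<alpha>) - \<alpha> * sin \<alpha>) / (4 * (1 - cos \<alpha>))\<^sup>2
      = (2 * (1 - cos \<alpha>) - \<alpha> * sin \<alpha>) / (4 * (1 - cos \<alpha>)\<^sup>2)"
    by (rule cancel)
  finally show ?thesis
  proof (rule has_field_derivative_transform_within_open)
    show "open (- {0::real})" by auto
    fix x :: real assume "x \<in> - {0}"
    then show "(x - sin x) / (4 * (1 - cos x)) = area_ratio x"
      by (simp add: area_ratio_def area_def norm_chord_squared)
  qed (use assms in auto)
qed

text \<open>
  Critical points of the ratio with \<open>\<alpha> \<noteq> 0\<close> and \<open>chord \<alpha> \<noteq> 0\<close> are simple. There the derivative is a positive multiple of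
  \<open>k \<alpha> = 2 (1 - cos \<alpha>) - \<alpha> sin \<alpha>\<close>, and \<open>k' \<alpha> = sin \<alpha> - \<alpha> cos \<alpha>\<close>. If both vanish, then
  \<open>2 cos \<alpha> (1 - cos \<alpha>) = \<alpha> sin \<alpha> cos \<alpha> = sin\<^sup>2 \<alpha> = (1 - cos \<alpha>) (1 + cos \<alpha>)\<close>, which forces
  \<open>cos \<alpha> = 1\<close>, that is, \<open>chord \<alpha> = 0\<close> because \<open>\<alpha> \<noteq> 0\<close>.
\<close>
lemma area_ratio_not_inj_near_critical_point:
  assumes nz: "\<alpha> \<noteq> 0" and ch: "chord \<alpha> \<noteq> 0" and crit: "(area_ratio has_real_derivative 0) (at \<alpha>)"
    and e: "e > 0" and good: "\<And>x. \<bar>x - \<alpha>\<bar> < e \<Longrightarrow> x \<noteq> 0 \<and> chord x \<noteq> 0"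
  shows "\<not> inj_on area_ratio {\<alpha> - e<..<\<alpha> + e}"
proof -
  define k where "k x = 2 * (1 - cos x) - x * sin x" for x :: real
  define s where "s = sin \<alpha>"
  define c where "c = cos \<alpha>"
  have c1: "c \<noteq> 1" using nz ch by (simp add: c_def chord_eq_0_iff)
  have "0 = k \<alpha> / (4 * (1 - cos \<alpha>)\<^sup>2)"
    using DERIV_unique[OF crit area_ratio_deriv[OF ch nz]] by (simp add: k_def)
  then have k0: "k \<alpha> = 0" using c1 by (simp add: c_def)
  then have k0': "2 * (1 - c) = \<alpha> * s" by (simp add: k_def s_def c_def)
  have sc: "s\<^sup>2 = (1 - c) * (1 + c)"
    using sin_squared_eq[of \<alpha>] by (simp add: s_def c_def power2_eq_square algebra_simps)
  have "s \<noteq> \<alpha> * c"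
  proof
    assume tan: "s = \<alpha> * c"
    have "(1 - c) * (2 * c) = (\<alpha> * s) * c" unfolding k0'[symmetric] by simp
    also have "\<dots> = s\<^sup>2" by (simp add: tan power2_eq_square)
    finally have "2 * c = 1 + c" using sc c1 by simp
    then show False using c1 by simp
  qed
  moreover have "((\<lambda>x. k x / (4 * (1 - cos x)\<^sup>2)) has_real_derivative
      (s - \<alpha> * c) / (4 * (1 - c)\<^sup>2)) (at \<alpha>)"
  proof -
    define r where "r x = 4 * (1 - cos x)\<^sup>2" for x :: real
    have r0: "r \<alpha> \<noteq> 0" using c1 by (simp add: r_def c_def)
    have "(k has_real_derivative (s - \<alpha> * c)) (at \<alpha>)"
      unfolding k_def s_def c_def by (auto intro!: derivative_eq_intros)
    moreover have "\<exists>D. (r has_real_derivative D) (at \<alpha>)"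
      unfolding r_def by (intro exI) (rule derivative_eq_intros refl | simp)+
    then obtain D where "(r has_real_derivative D) (at \<alpha>)" ..
    ultimately have "((\<lambda>x. k x / r x) has_real_derivative
        ((s - \<alpha> * c) * r \<alpha> - k \<alpha> * D) / (r \<alpha> * r \<alpha>)) (at \<alpha>)"
      using r0 by (intro DERIV_divide)
    then have "((\<lambda>x. k x / r x) has_real_derivative (s - \<alpha> * c) / r \<alpha>) (at \<alpha>)"
      using r0 by (simp add: k0)
    then show ?thesis by (simp add: r_def c_def)
  qed
  ultimately show ?thesis
    using area_ratio_deriv good k0 c1
    by (intro not_inj_near_simple_critical_point[where f' = "\<lambda>x. k x / (4 * (1 - cos x)\<^sup>2)"
          and D = "(s - \<alpha> * c) / (4 * (1 - c)\<^sup>2)"] e) (auto simp: k_def)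
qed

section \<open>Hamiltonian curves\<close>

lemma symplectic_form_nondegenerate:
  assumes "\<And>z. symplectic_form z w = symplectic_form z w'"
  shows "w = w'"
proof -
  define d where "d = w - w'"
  have "symplectic_form z d = symplectic_form z w - symplectic_form z w'" for z
    by (simp add: symplectic_form_def inner_diff_right d_def)
  then have "symplectic_form z d = 0" for z using assms by simp
  \<comment> \<open>Pairing with the vector rotated by the standard complex structure gives the Euclidean norm.\<close>
  from this[of "(- snd d, fst d)"] have "d \<bullet> d = 0"
    by (simp add: symplectic_form_def inner_prod_def)
  then show ?thesis by (simp add: d_def)
qed

lemma hamiltonian_vector_field_hamiltonian:
  "hamiltonian_vector_field hamiltonian ((x, y, \<tau>), (u, v, \<alpha>)) =
     (let a = u - \<alpha> * y / 2; b = v + \<alpha> * x / 2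
      in ((a, b, (x * b - y * a) / 2), (- \<alpha> * b / 2, \<alpha> * a / 2, 0)))"
proof -
  define a b where "a = u - \<alpha> * y / 2" and "b = v + \<alpha> * x / 2"
  let ?z = "((x, y, \<tau>), (u, v, \<alpha>))"
  let ?W = "((a, b, (x * b - y * a) / 2), (- \<alpha> * b / 2, \<alpha> * a / 2, 0))"
  have ham: "hamiltonian = (\<lambda>z. ((fst (snd z) - snd (snd (snd z)) * fst (snd (fst z)) / 2)\<^sup>2
      + (fst (snd (snd z)) + snd (snd (snd z)) * fst (fst z) / 2)\<^sup>2) / 2)"
    by (auto simp: hamiltonian_coords)
  have "(hamiltonian has_derivative (\<lambda>z. symplectic_form z ?W)) (at ?z)"
    unfolding ham
    by (rule derivative_eq_intros refl | simp)+
       (auto simp: symplectic_form_def a_def b_def fun_eq_iff field_simps power2_eq_square)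
  then have D: "frechet_derivative hamiltonian (at ?z) = (\<lambda>z. symplectic_form z ?W)"
    by (rule frechet_derivative_at[symmetric])
  show ?thesis
    unfolding hamiltonian_vector_field_def D Let_def a_def[symmetric] b_def[symmetric]
    by (intro the_equality symplectic_form_nondegenerate) auto
qed

lemma zero_derivative_imp_eq_endpoints:
  fixes F :: "real \<Rightarrow> real"
  assumes "\<And>t. t \<in> {0..1} \<Longrightarrow> (F has_real_derivative 0) (at t within {0..1})"
  shows "F 1 = F 0"
proof -
  have "\<exists>c. \<forall>t\<in>{0..1}. F t = c"
    using assms by (intro has_field_derivative_zero_constant) auto
  then show ?thesis by auto
qed

text \<open>
  Hamilton's equations. The combinations \<open>a = u - \<alpha> y / 2\<close> and \<open>b = v + \<alpha> x / 2\<close>, which are the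
  pairings of the covector with \<open>X1\<close> and \<open>X2\<close>, are the velocity of the projection to the
  \<open>(x, y)\<close>-plane.
\<close>
lemma hamiltonian_curve_coordinates:
  assumes "integral_curve_on (hamiltonian_vector_field hamiltonian) I \<gamma>"
  obtains x y \<tau> u v \<alpha> where "\<gamma> = (\<lambda>t. ((x t, y t, \<tau> t), (u t, v t, \<alpha> t)))"
    "\<And>t. t \<in> I \<Longrightarrow> (x has_real_derivative u t - \<alpha> t * y t / 2) (at t within I)"
    "\<And>t. t \<in> I \<Longrightarrow> (y has_real_derivative v t + \<alpha> t * x t / 2) (at t within I)"
    "\<And>t. t \<in> I \<Longrightarrow> (\<tau> has_real_derivative
       (x t * (v t + \<alpha> t * x t / 2) - y t * (u t - \<alpha> t * y t / 2)) / 2) (at t within I)"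
    "\<And>t. t \<in> I \<Longrightarrow> (u has_real_derivative - \<alpha> t * (v t + \<alpha> t * x t / 2) / 2) (at t within I)"
    "\<And>t. t \<in> I \<Longrightarrow> (v has_real_derivative \<alpha> t * (u t - \<alpha> t * y t / 2) / 2) (at t within I)"
    "\<And>t. t \<in> I \<Longrightarrow> (\<alpha> has_real_derivative 0) (at t within I)"
proof -
  define x y \<tau> u v \<alpha> where "x = (\<lambda>t. fst (fst (\<gamma> t)))" and "y = (\<lambda>t. fst (snd (fst (\<gamma> t))))"
    and "\<tau> = (\<lambda>t. snd (snd (fst (\<gamma> t))))" and "u = (\<lambda>t. fst (snd (\<gamma> t)))"
    and "v = (\<lambda>t. fst (snd (snd (\<gamma> t))))" and "\<alpha> = (\<lambda>t. snd (snd (snd (\<gamma> t))))"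
  note coord_defs = x_def y_def \<tau>_def u_def v_def \<alpha>_def
  have \<gamma>: "\<gamma> = (\<lambda>t. ((x t, y t, \<tau> t), (u t, v t, \<alpha> t)))" by (simp add: coord_defs)
  have vel: "(\<gamma> has_vector_derivative
      (let a = u t - \<alpha> t * y t / 2; b = v t + \<alpha> t * x t / 2
       in ((a, b, (x t * b - y t * a) / 2), (- \<alpha> t * b / 2, \<alpha> t * a / 2, 0)))) (at t within I)"
    if "t \<in> I" for t
    using assms that hamiltonian_vector_field_hamiltonian[of "x t" "y t" "\<tau> t" "u t" "v t" "\<alpha> t"]
    by (metis (no_types, lifting) \<gamma> integral_curve_on_def)
  have comp: "((\<lambda>t. f (\<gamma> t)) has_vector_derivative
      f (let a = u t - \<alpha> t * y t / 2; b = v t + \<alpha> t * x t / 2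
       in ((a, b, (x t * b - y t * a) / 2), (- \<alpha> t * b / 2, \<alpha> t * a / 2, 0)))) (at t within I)"
    if "bounded_linear f" "t \<in> I" for f :: "cotangent \<Rightarrow> real" and t
    using bounded_linear.has_vector_derivative[OF that(1) vel[OF that(2)]] .
  have bl: "bounded_linear (\<lambda>z::cotangent. fst (fst z))" "bounded_linear (\<lambda>z::cotangent. fst (snd (fst z)))"
    "bounded_linear (\<lambda>z::cotangent. snd (snd (fst z)))" "bounded_linear (\<lambda>z::cotangent. fst (snd z))"
    "bounded_linear (\<lambda>z::cotangent. fst (snd (snd z)))" "bounded_linear (\<lambda>z::cotangent. snd (snd (snd z)))"
    by (intro bounded_linear_fst_comp bounded_linear_snd_comp bounded_linear_ident)+
  show thesis
    by (rule that[OF \<gamma>])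
       (use comp[OF bl(1)] comp[OF bl(2)] comp[OF bl(3)] comp[OF bl(4)] comp[OF bl(5)] comp[OF bl(6)]
        in \<open>auto simp: Let_def coord_defs has_real_derivative_iff_has_vector_derivative\<close>)
qed

text \<open>
  The exponential map at the identity. A covector is encoded as \<open>(w, \<alpha>)\<close>, where \<open>w\<close> is its
  \<open>(u, v)\<close>-part as a complex number: if \<open>w \<noteq> 0\<close>, the plane projection of its curve is an arc of curvature
  \<open>\<alpha> / norm w\<close> and length \<open>norm w\<close>, and the vertical coordinate records the area swept.
\<close>
definition std_exp :: "complex \<times> real \<Rightarrow> complex \<times> real" where
  "std_exp = (\<lambda>(w, \<alpha>). (w * chord \<alpha>, (norm w)\<^sup>2 * area \<alpha>))"

definition left_translate :: "heis \<Rightarrow> complex \<times> real \<Rightarrow> heis" where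
  "left_translate = (\<lambda>(x, y, \<tau>) (z, s). (x + Re z, y + Im z, \<tau> + (x * Im z - y * Re z) / 2 + s))"

text \<open>
  The pullback of a covector at a point to the identity by the left translation to that point;
  its complex component is \<open>\<langle>p, X1\<rangle> + \<i> \<langle>p, X2\<rangle>\<close>.
\<close>
definition left_momentum :: "heis \<Rightarrow> covec \<Rightarrow> complex \<times> real" where
  "left_momentum = (\<lambda>(x, y, \<tau>) (u, v, \<alpha>). (Complex (u - \<alpha> * y / 2) (v + \<alpha> * x / 2), \<alpha>))"

text \<open>
  The endpoint of an arbitrary solution can be read off from conserved quantities. With
  \<open>w = a + \<i> b\<close> and \<open>z = x + \<i> y\<close> the equations are \<open>z' = w\<close>, \<open>w' = \<i> \<alpha> w\<close> and \<open>\<tau>' = (x b - y a) / 2\<close>. Hence \<open>\<alpha>\<close>,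
  \<open>w exp (- \<i> \<alpha> t)\<close> and \<open>w - \<i> \<alpha> z\<close> are constant; the last one determines \<open>z\<close> if \<open>\<alpha> \<noteq> 0\<close>, and
  determines the \<open>(u, v)\<close>-part of the covector from the point in every case.
\<close>
lemma hamiltonian_curve_endpoint:
  assumes curve: "integral_curve_on (hamiltonian_vector_field hamiltonian) {0..1} \<gamma>"
    and start: "\<gamma> 0 = ((x0, y0, \<tau>0), (u0, v0, \<alpha>0))"
    and stop: "\<gamma> 1 = ((x1, y1, \<tau>1), (u1, v1, \<alpha>1))"
  shows "(u1, v1, \<alpha>1) = (u0 + \<alpha>0 * (y0 - y1) / 2, v0 + \<alpha>0 * (x1 - x0) / 2, \<alpha>0)" (is ?covector)
    and "(x1, y1, \<tau>1) =
      left_translate (x0, y0, \<tau>0) (std_exp (left_momentum (x0, y0, \<tau>0) (u0, v0, \<alpha>0)))" (is ?point)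
proof -
  obtain x y \<tau> u v \<alpha> where \<gamma>: "\<gamma> = (\<lambda>t. ((x t, y t, \<tau> t), (u t, v t, \<alpha> t)))"
    and x': "\<And>t. t \<in> {0..1} \<Longrightarrow> (x has_real_derivative u t - \<alpha> t * y t / 2) (at t within {0..1})"
    and y': "\<And>t. t \<in> {0..1} \<Longrightarrow> (y has_real_derivative v t + \<alpha> t * x t / 2) (at t within {0..1})"
    and \<tau>': "\<And>t. t \<in> {0..1} \<Longrightarrow> (\<tau> has_real_derivative
       (x t * (v t + \<alpha> t * x t / 2) - y t * (u t - \<alpha> t * y t / 2)) / 2) (at t within {0..1})"
    and u': "\<And>t. t \<in> {0..1} \<Longrightarrow> (u has_real_derivative - \<alpha> t * (v t + \<alpha> t * x t / 2) / 2) (at t within {0..1})"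
    and v': "\<And>t. t \<in> {0..1} \<Longrightarrow> (v has_real_derivative \<alpha> t * (u t - \<alpha> t * y t / 2) / 2) (at t within {0..1})"
    and \<alpha>': "\<And>t. t \<in> {0..1} \<Longrightarrow> (\<alpha> has_real_derivative 0) (at t within {0..1})"
    by (rule hamiltonian_curve_coordinates[OF curve]) (rule that)
  note derivs = x' y' \<tau>' u' v' \<alpha>'
  have at0: "x 0 = x0" "y 0 = y0" "\<tau> 0 = \<tau>0" "u 0 = u0" "v 0 = v0" "\<alpha> 0 = \<alpha>0"
    and at1: "x 1 = x1" "y 1 = y1" "\<tau> 1 = \<tau>1" "u 1 = u1" "v 1 = v1" "\<alpha> 1 = \<alpha>1"
    using start stop \<gamma> by auto
  define a where "a t = u t - \<alpha> t * y t / 2" for t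
  define b where "b t = v t + \<alpha> t * x t / 2" for t
  have a': "(a has_real_derivative - \<alpha> t * b t) (at t within {0..1})" if "t \<in> {0..1}" for t
    unfolding a_def b_def using that by (auto intro!: derivative_eq_intros derivs simp: field_simps)
  have b': "(b has_real_derivative \<alpha> t * a t) (at t within {0..1})" if "t \<in> {0..1}" for t
    unfolding a_def b_def using that by (auto intro!: derivative_eq_intros derivs simp: field_simps)
  define a0 b0 where "a0 = a 0" and "b0 = b 0"
  have A: "\<alpha>1 = \<alpha>0"
    using zero_derivative_imp_eq_endpoints[of \<alpha>, OF \<alpha>'] at0 at1 by simp
  have "u 1 + \<alpha> 1 * y 1 / 2 = u 0 + \<alpha> 0 * y 0 / 2"
    by (rule zero_derivative_imp_eq_endpoints)
       (auto intro!: derivative_eq_intros derivs simp: field_simps)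
  then have cu: "u1 + \<alpha>0 * y1 / 2 = u0 + \<alpha>0 * y0 / 2" by (simp add: at0 at1 A)
  have "v 1 - \<alpha> 1 * x 1 / 2 = v 0 - \<alpha> 0 * x 0 / 2"
    by (rule zero_derivative_imp_eq_endpoints)
       (auto intro!: derivative_eq_intros derivs simp: field_simps)
  then have cv: "v1 - \<alpha>0 * x1 / 2 = v0 - \<alpha>0 * x0 / 2" by (simp add: at0 at1 A)
  show ?covector using cu cv A by (simp add: field_simps)
  have mom: "left_momentum (x0, y0, \<tau>0) (u0, v0, \<alpha>0) = (Complex a0 b0, \<alpha>0)"
    by (simp add: left_momentum_def a0_def b0_def a_def b_def at0)
  have norm: "(norm (Complex a0 b0))\<^sup>2 = a0\<^sup>2 + b0\<^sup>2" by (simp add: cmod_power2)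
  show ?point
  proof (cases "\<alpha>0 = 0")
    case True
    have \<alpha>0: "\<alpha> t = 0" if "t \<in> {0..1}" for t
    proof -
      have "\<exists>c. \<forall>t\<in>{0..1}. \<alpha> t = c"
        using \<alpha>' by (intro has_field_derivative_zero_constant) auto
      then show ?thesis using that True at0 by force
    qed
    \<comment> \<open>The curve projects to a straight line, traversed with constant velocity.\<close>
    have "x 1 - 1 * a 1 = x 0 - 0 * a 0"
      by (rule zero_derivative_imp_eq_endpoints[where F = "\<lambda>t. x t - t * a t"])
         (auto intro!: derivative_eq_intros derivs a' simp: \<alpha>0, auto simp: a_def \<alpha>0)
    moreover have "y 1 - 1 * b 1 = y 0 - 0 * b 0"
      by (rule zero_derivative_imp_eq_endpoints[where F = "\<lambda>t. y t - t * b t"])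
         (auto intro!: derivative_eq_intros derivs b' simp: \<alpha>0, auto simp: b_def \<alpha>0)
    moreover have "\<tau> 1 - 1 * (x 1 * b 1 - y 1 * a 1) / 2 = \<tau> 0 - 0 * (x 0 * b 0 - y 0 * a 0) / 2"
      by (rule zero_derivative_imp_eq_endpoints[where F = "\<lambda>t. \<tau> t - t * (x t * b t - y t * a t) / 2"])
         (auto intro!: derivative_eq_intros derivs a' b' simp: \<alpha>0, auto simp: a_def b_def \<alpha>0 algebra_simps)
    moreover have "a 1 = a 0"
      by (rule zero_derivative_imp_eq_endpoints[where F = a]) (use a' \<alpha>0 in force)
    moreover have "b 1 = b 0"
      by (rule zero_derivative_imp_eq_endpoints[where F = b]) (use b' \<alpha>0 in force)
    ultimately have "x1 = x0 + a0" "y1 = y0 + b0" "\<tau>1 = \<tau>0 + (x1 * b0 - y1 * a0) / 2"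
      by (simp_all add: at0 at1 a0_def b0_def)
    then have "x1 = x0 + a0" "y1 = y0 + b0" "\<tau>1 = \<tau>0 + (x0 * b0 - y0 * a0) / 2"
      by (simp_all add: algebra_simps)
    then show ?thesis
      unfolding mom by (simp add: True std_exp_def chord_def area_def left_translate_def)
  next
    case False
    \<comment> \<open>Real and imaginary part of the constant \<open>w exp (- \<i> \<alpha> t)\<close>.\<close>
    have "a 1 * cos (\<alpha> 1 * 1) + b 1 * sin (\<alpha> 1 * 1) = a 0 * cos (\<alpha> 0 * 0) + b 0 * sin (\<alpha> 0 * 0)"
      by (rule zero_derivative_imp_eq_endpoints[where F = "\<lambda>t. a t * cos (\<alpha> t * t) + b t * sin (\<alpha> t * t)"])
         (auto intro!: derivative_eq_intros derivs a' b' simp: algebra_simps)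
    then have P: "a 1 * cos \<alpha>0 + b 1 * sin \<alpha>0 = a0" by (simp add: at0 at1 A a0_def)
    have "b 1 * cos (\<alpha> 1 * 1) - a 1 * sin (\<alpha> 1 * 1) = b 0 * cos (\<alpha> 0 * 0) - a 0 * sin (\<alpha> 0 * 0)"
      by (rule zero_derivative_imp_eq_endpoints[where F = "\<lambda>t. b t * cos (\<alpha> t * t) - a t * sin (\<alpha> t * t)"])
         (auto intro!: derivative_eq_intros derivs a' b' simp: algebra_simps)
    then have Q: "b 1 * cos \<alpha>0 - a 1 * sin \<alpha>0 = b0" by (simp add: at0 at1 A b0_def)
    have sc: "(sin \<alpha>0)\<^sup>2 + (cos \<alpha>0)\<^sup>2 = 1" by simp
    have a1: "a 1 = a0 * cos \<alpha>0 - b0 * sin \<alpha>0"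
      unfolding P[symmetric] Q[symmetric] using sc by algebra
    have b1: "b 1 = a0 * sin \<alpha>0 + b0 * cos \<alpha>0"
      unfolding P[symmetric] Q[symmetric] using sc by algebra
    have "\<alpha>0 * (x1 - x0) = b 1 - b0" "\<alpha>0 * (y1 - y0) = a0 - a 1"
      using cu cv by (simp_all add: a_def b_def a0_def b0_def at0 at1 A algebra_simps)
    then have X: "x1 - x0 = (b 1 - b0) / \<alpha>0" and Y: "y1 - y0 = (a0 - a 1) / \<alpha>0"
      using False by (simp_all add: eq_divide_eq mult.commute)
    \<comment> \<open>Substituting \<open>\<alpha> x = b - c\<^sub>2\<close> and \<open>\<alpha> y = c\<^sub>1 - a\<close>, with \<open>c\<^sub>1\<close> and \<open>c\<^sub>2\<close> constant, into \<open>\<alpha> \<tau>'\<close> gives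
      \<open>(a\<^sup>2 + b\<^sup>2 - c\<^sub>1 x' - c\<^sub>2 y') / 2\<close>, where \<open>a\<^sup>2 + b\<^sup>2\<close> is constant; integrating gives this quantity.\<close>
    have "\<alpha> 1 * \<tau> 1 - 1 * ((a 1)\<^sup>2 + (b 1)\<^sup>2) / 2 + ((a 1 + \<alpha> 1 * y 1) * x 1 + (b 1 - \<alpha> 1 * x 1) * y 1) / 2
        = \<alpha> 0 * \<tau> 0 - 0 * ((a 0)\<^sup>2 + (b 0)\<^sup>2) / 2 + ((a 0 + \<alpha> 0 * y 0) * x 0 + (b 0 - \<alpha> 0 * x 0) * y 0) / 2"
    proof (rule zero_derivative_imp_eq_endpoints[where F = "\<lambda>t. \<alpha> t * \<tau> t - t * ((a t)\<^sup>2 + (b t)\<^sup>2) / 2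
        + ((a t + \<alpha> t * y t) * x t + (b t - \<alpha> t * x t) * y t) / 2"])
      fix t :: real assume t: "t \<in> {0..1}"
      show "((\<lambda>t. \<alpha> t * \<tau> t - t * ((a t)\<^sup>2 + (b t)\<^sup>2) / 2
        + ((a t + \<alpha> t * y t) * x t + (b t - \<alpha> t * x t) * y t) / 2) has_real_derivative 0) (at t within {0..1})"
        by (rule derivative_eq_intros x'[OF t, folded a_def] y'[OF t, folded b_def]
              \<tau>'[OF t, folded a_def b_def] \<alpha>'[OF t]  a'[OF t] b'[OF t] refl | (simp; fail))+
           (simp add: field_simps power2_eq_square)
    qed
    then have R: "\<alpha>0 * \<tau>1 - ((a 1)\<^sup>2 + (b 1)\<^sup>2) / 2 + ((a 1 + \<alpha>0 * y1) * x1 + (b 1 - \<alpha>0 * x1) * y1) / 2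
        = \<alpha>0 * \<tau>0 + ((a0 + \<alpha>0 * y0) * x0 + (b0 - \<alpha>0 * x0) * y0) / 2"
      by (simp add: at0 at1 A a0_def b0_def)
    have X': "x1 = x0 + (a0 * sin \<alpha>0 - b0 * (1 - cos \<alpha>0)) / \<alpha>0"
      using X unfolding b1 by (simp add: algebra_simps)
    have Y': "y1 = y0 + (a0 * (1 - cos \<alpha>0) + b0 * sin \<alpha>0) / \<alpha>0"
      using Y unfolding a1 by (simp add: algebra_simps)
    have K: "(a 1)\<^sup>2 + (b 1)\<^sup>2 = a0\<^sup>2 + b0\<^sup>2"
      unfolding a1 b1 using sc by algebra
    have lin: "a 1 + \<alpha>0 * y1 = a0 + \<alpha>0 * y0" "b 1 - \<alpha>0 * x1 = b0 - \<alpha>0 * x0"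
      using X Y False by (simp_all add: field_simps)
    have dot: "a0 * (x1 - x0) + b0 * (y1 - y0) = (a0\<^sup>2 + b0\<^sup>2) * sin \<alpha>0 / \<alpha>0"
      unfolding X' Y' using False by (simp add: field_simps power2_eq_square)
    have half_sum: "\<alpha>0 * ((a0\<^sup>2 + b0\<^sup>2) * area \<alpha>0)
        = (a0\<^sup>2 + b0\<^sup>2) / 2 - (a0\<^sup>2 + b0\<^sup>2) * sin \<alpha>0 / \<alpha>0 / 2"
      unfolding area_def using False by (simp add: divide_simps power2_eq_square) algebra
    have "\<alpha>0 * (\<tau>1 - \<tau>0) = (a0\<^sup>2 + b0\<^sup>2) / 2 - (a0 * (x1 - x0) + b0 * (y1 - y0)) / 2
        + \<alpha>0 * (x0 * (y1 - y0) - y0 * (x1 - x0)) / 2"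
      using R unfolding K lin by (simp add: algebra_simps add_divide_distrib diff_divide_distrib)
    also have "\<dots> = \<alpha>0 * ((a0\<^sup>2 + b0\<^sup>2) * area \<alpha>0 + (x0 * (y1 - y0) - y0 * (x1 - x0)) / 2)"
      unfolding dot distrib_left half_sum by simp
    finally have "\<tau>1 = \<tau>0 + (x0 * (y1 - y0) - y0 * (x1 - x0)) / 2 + (a0\<^sup>2 + b0\<^sup>2) * area \<alpha>0"
      using False by simp
    moreover have "x1 = x0 + Re (Complex a0 b0 * chord \<alpha>0)" "y1 = y0 + Im (Complex a0 b0 * chord \<alpha>0)"
      unfolding X' Y' using False by (simp_all add: chord_coords field_simps)
    ultimately show ?thesis
      unfolding mom std_exp_def left_translate_def by (simp add: norm)
  qed
qed

text \<open>
  All Hamiltonian curves from \<open>(q, p)\<close> end at the same point with the same covector, so the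
  definite description in \<open>flow\<close> picks out the actual endpoint.
\<close>
lemma sR_exp_eq_std_exp:
  assumes "p \<in> exp_domain q"
  shows "sR_exp q p = left_translate q (std_exp (left_momentum q p))"
proof -
  let ?V = "hamiltonian_vector_field hamiltonian"
  obtain \<gamma> where \<gamma>: "integral_curve_on ?V {0..1} \<gamma>" "\<gamma> 0 = (q, p)"
    using assms by (auto simp: exp_domain_def)
  obtain x0 y0 \<tau>0 u0 v0 \<alpha>0 where qp: "q = (x0, y0, \<tau>0)" "p = (u0, v0, \<alpha>0)"
    by (metis surj_pair)
  have same_point: "fst (\<delta> 1) = left_translate q (std_exp (left_momentum q p))"
    and same_covec: "snd (\<delta> 1) = (u0 + \<alpha>0 * (y0 - fst (snd (fst (\<delta> 1)))) / 2,
                                    v0 + \<alpha>0 * (fst (fst (\<delta> 1)) - x0) / 2, \<alpha>0)"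
    if "integral_curve_on ?V {0..1} \<delta>" "\<delta> 0 = (q, p)" for \<delta>
  proof -
    obtain x1 y1 \<tau>1 u1 v1 \<alpha>1 where 1: "\<delta> 1 = ((x1, y1, \<tau>1), (u1, v1, \<alpha>1))"
      by (metis surj_pair)
    show "fst (\<delta> 1) = left_translate q (std_exp (left_momentum q p))"
      using hamiltonian_curve_endpoint(2)[OF that(1) _ 1] that(2) by (simp add: qp 1)
    show "snd (\<delta> 1) = (u0 + \<alpha>0 * (y0 - fst (snd (fst (\<delta> 1)))) / 2,
                                    v0 + \<alpha>0 * (fst (fst (\<delta> 1)) - x0) / 2, \<alpha>0)"
      using hamiltonian_curve_endpoint(1)[OF that(1) _ 1] that(2) by (simp add: qp 1)
  qed
  have unique: "\<delta> 1 = \<gamma> 1" if "integral_curve_on ?V {0..1} \<delta>" "\<delta> 0 = (q, p)" for \<delta>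
    using same_point[OF that] same_covec[OF that] same_point[OF \<gamma>] same_covec[OF \<gamma>]
    by (simp add: prod_eq_iff)
  have unit: "closed_segment 0 1 = {0..1::real}"
    by (simp add: closed_segment_eq_real_ivl)
  have "flow ?V 1 (q, p) = \<gamma> 1"
    unfolding flow_def unit
  proof (rule the_equality)
    show "\<exists>\<delta>. integral_curve_on ?V {0..1} \<delta> \<and> \<delta> 0 = (q, p) \<and> \<delta> 1 = \<gamma> 1"
      using \<gamma> by blast
  qed (use unique in blast)
  then show ?thesis using same_point[OF \<gamma>] by (simp add: sR_exp_def)
qed

section \<open>Critical points of the exponential map at the identity\<close>

lemma std_exp_has_derivative:
  assumes c: "(chord has_vector_derivative c) (at \<alpha>)" and a: "(area has_real_derivative a) (at \<alpha>)"
  shows "(std_exp has_derivative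
     (\<lambda>h. (fst h * chord \<alpha> + w * (snd h *\<^sub>R c),
           2 * (w \<bullet> fst h) * area \<alpha> + (norm w)\<^sup>2 * (snd h * a)))) (at (w, \<alpha>))"
proof -
  have ch: "((\<lambda>z::complex \<times> real. chord (snd z)) has_derivative (\<lambda>h. snd h *\<^sub>R c)) (at (w, \<alpha>))"
    using c unfolding has_vector_derivative_def
    by (intro has_derivative_compose[where g = chord, OF has_derivative_snd[OF has_derivative_ident]]) simp
  have ar: "((\<lambda>z::complex \<times> real. area (snd z)) has_derivative (\<lambda>h. snd h * a)) (at (w, \<alpha>))"
    using a unfolding has_field_derivative_def mult.commute[of a]
    by (intro has_derivative_compose[where g = area, OF has_derivative_snd[OF has_derivative_ident]]) simp
  have eq: "std_exp = (\<lambda>z. (fst z * chord (snd z), (fst z \<bullet> fst z) * area (snd z)))"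
    by (auto simp: std_exp_def power2_norm_eq_inner)
  show ?thesis
    unfolding eq
    by (auto intro!: derivative_eq_intros ch ar
        simp: power2_norm_eq_inner inner_commute algebra_simps)
qed

lemma inner_mult_left_complex:
  fixes w z z' :: complex
  shows "(w * z) \<bullet> (w * z') = (norm w)\<^sup>2 * (z \<bullet> z')"
  by (simp only: inner_complex_def cmod_power2) (simp add: power2_eq_square algebra_simps)

text \<open>
  If \<open>chord \<alpha> \<noteq> 0\<close>, the first kernel equation determines \<open>dw\<close> from \<open>d\<alpha>\<close>, so \<open>d\<alpha> \<noteq> 0\<close>. Taking the
  inner product of that equation with \<open>w * chord \<alpha>\<close> and eliminating \<open>w \<bullet> dw\<close> from the second one
  leaves \<open>m a = m' area \<alpha>\<close> for \<open>m = (norm (chord \<alpha>))\<^sup>2\<close>, the vanishing of the derivative of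
  \<open>area / m\<close>. At \<open>\<alpha> = 0\<close> this would say \<open>1 / 12 = 0\<close>.
\<close>
lemma critical_std_exp_imp_critical_area_ratio:
  assumes c: "(chord has_vector_derivative c) (at \<alpha>)" and a: "(area has_real_derivative a) (at \<alpha>)"
    and w: "w \<noteq> 0" and ch: "chord \<alpha> \<noteq> 0" and h: "(dw, d\<alpha>) \<noteq> 0"
    and ker1: "dw * chord \<alpha> + w * (d\<alpha> *\<^sub>R c) = 0"
    and ker2: "2 * (w \<bullet> dw) * area \<alpha> + (norm w)\<^sup>2 * (d\<alpha> * a) = 0"
  shows "\<alpha> \<noteq> 0" and "(area_ratio has_real_derivative 0) (at \<alpha>)"
proof -
  let ?m = "(norm (chord \<alpha>))\<^sup>2"
  have d\<alpha>: "d\<alpha> \<noteq> 0" using ker1 ch h by (auto simp: zero_prod_def)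
  have "(w \<bullet> dw) * ?m = (chord \<alpha> * w) \<bullet> (chord \<alpha> * dw)"
    by (simp add: inner_mult_left_complex)
  also have "\<dots> = (w * chord \<alpha>) \<bullet> (w * (- d\<alpha> *\<^sub>R c))"
    using ker1 by (simp add: add_eq_0_iff2 mult.commute)
  also have "\<dots> = - (norm w)\<^sup>2 * d\<alpha> * (chord \<alpha> \<bullet> c)"
    by (simp add: inner_mult_left_complex)
  finally have wdw: "(w \<bullet> dw) * ?m = - (norm w)\<^sup>2 * d\<alpha> * (chord \<alpha> \<bullet> c)" .
  have "(norm w)\<^sup>2 * d\<alpha> * (a * ?m - 2 * (chord \<alpha> \<bullet> c) * area \<alpha>)
      = (norm w)\<^sup>2 * (d\<alpha> * a) * ?m + 2 * ((w \<bullet> dw) * ?m) * area \<alpha>"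
    unfolding wdw by (simp add: algebra_simps)
  also have "\<dots> = (2 * (w \<bullet> dw) * area \<alpha> + (norm w)\<^sup>2 * (d\<alpha> * a)) * ?m"
    by (simp add: algebra_simps)
  finally have log_deriv: "a * ?m = 2 * (chord \<alpha> \<bullet> c) * area \<alpha>"
    using ker2 w d\<alpha> by simp
  show "\<alpha> \<noteq> 0"
  proof
    assume "\<alpha> = 0"
    then show False
      using log_deriv ch DERIV_unique[OF area_deriv_0, of a] a by (simp add: area_def)
  qed
  have eq: "area_ratio = (\<lambda>x. area x / (chord x \<bullet> chord x))"
    by (simp add: fun_eq_iff area_ratio_def power2_norm_eq_inner)
  have m': "((\<lambda>x. chord x \<bullet> chord x) has_real_derivative 2 * (chord \<alpha> \<bullet> c)) (at \<alpha>)"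
    using has_derivative_inner[OF c[unfolded has_vector_derivative_def] c[unfolded has_vector_derivative_def]]
    by (simp add: has_field_derivative_def inner_commute algebra_simps mult_commute_abs)
  have "(area_ratio has_real_derivative
      (a * (chord \<alpha> \<bullet> chord \<alpha>) - area \<alpha> * (2 * (chord \<alpha> \<bullet> c))) / ((chord \<alpha> \<bullet> chord \<alpha>) * (chord \<alpha> \<bullet> chord \<alpha>))) (at \<alpha>)"
    unfolding eq using ch by (intro DERIV_divide a m') simp
  then show "(area_ratio has_real_derivative 0) (at \<alpha>)"
    using log_deriv by (simp add: power2_norm_eq_inner mult.commute)
qed

text \<open>
  If the arc is a union of full circles, its endpoint is independent of its initial direction, so
  \<open>w\<close> can be rotated.
\<close>
lemma std_exp_not_inj_if_chord_0:
  assumes M: "open M" "(w, \<alpha>) \<in> M" and w: "w \<noteq> 0" and ch: "chord \<alpha> = 0"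
  shows "\<not> inj_on std_exp M"
proof -
  have "isCont (\<lambda>\<theta>. (w * cis \<theta>, \<alpha>)) 0"
    unfolding cis_conv_exp by (intro continuous_intros)
  then have "\<forall>\<^sub>F \<theta> in at 0. (w * cis \<theta>, \<alpha>) \<in> M"
    using M by (intro topological_tendstoD) (auto simp: isCont_def)
  then obtain d where d: "d > 0" "\<And>\<theta>. \<theta> \<noteq> 0 \<Longrightarrow> \<bar>\<theta>\<bar> < d \<Longrightarrow> (w * cis \<theta>, \<alpha>) \<in> M"
    by (auto simp: eventually_at dist_real_def)
  define \<theta> where "\<theta> = min d 1 / 2"
  have \<theta>: "0 < \<theta>" "\<theta> < d" "\<theta> < pi" using d(1) pi_gt3 by (auto simp: \<theta>_def)
  have "sin \<theta> \<noteq> 0" using sin_gt_zero[of \<theta>] \<theta> by simp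
  then have "cis \<theta> \<noteq> 1" by (auto simp: complex_eq_iff)
  then have "(w * cis \<theta>, \<alpha>) \<noteq> (w, \<alpha>)" using w by simp
  moreover have "std_exp (w * cis \<theta>, \<alpha>) = std_exp (w, \<alpha>)"
    by (simp add: std_exp_def ch norm_mult)
  ultimately show ?thesis
    using M(2) d(2)[of \<theta>] \<theta> by (metis abs_of_pos inj_onD less_irrefl)
qed

text \<open>
  Near a critical point of the ratio there are two curvature parameters with the same ratio. The
  corresponding arcs can be scaled and rotated to have the same chord, and then they also enclose
  the same area.
\<close>
lemma std_exp_not_inj_if_critical_area_ratio:
  assumes M: "open M" "(w, \<alpha>) \<in> M" and w: "w \<noteq> 0" and ch: "chord \<alpha> \<noteq> 0" and nz: "\<alpha> \<noteq> 0"
    and crit: "(area_ratio has_real_derivative 0) (at \<alpha>)"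
  shows "\<not> inj_on std_exp M"
proof -
  \<comment> \<open>Covectors near \<open>(w, \<alpha>)\<close> whose curves end above the same point of the plane.\<close>
  define path where "path \<beta> = (w * chord \<alpha> / chord \<beta>, \<beta>)" for \<beta>
  have cont: "isCont chord \<alpha>"
    using chord_differentiable[of \<alpha>] has_vector_derivative_continuous by blast
  have "isCont path \<alpha>"
    unfolding path_def using cont ch by (intro continuous_intros) auto
  moreover have "path \<alpha> \<in> M" using M ch by (simp add: path_def)
  ultimately have "\<forall>\<^sub>F \<beta> in at \<alpha>. path \<beta> \<in> M"
    using M by (intro topological_tendstoD) (auto simp: isCont_def)
  moreover have "\<forall>\<^sub>F \<beta> in at \<alpha>. chord \<beta> \<noteq> 0"
    using cont ch by (intro tendsto_imp_eventually_ne) (auto simp: isCont_def)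
  moreover have "\<forall>\<^sub>F \<beta> in at \<alpha>. \<beta> \<noteq> 0"
    using nz by (intro tendsto_imp_eventually_ne) auto
  ultimately have "\<forall>\<^sub>F \<beta> in at \<alpha>. path \<beta> \<in> M \<and> chord \<beta> \<noteq> 0 \<and> \<beta> \<noteq> 0"
    by eventually_elim auto
  then obtain e where e: "e > 0"
    and "\<And>\<beta>. \<beta> \<noteq> \<alpha> \<Longrightarrow> \<bar>\<beta> - \<alpha>\<bar> < e \<Longrightarrow> path \<beta> \<in> M \<and> chord \<beta> \<noteq> 0 \<and> \<beta> \<noteq> 0"
    by (auto simp: eventually_at dist_real_def)
  with \<open>path \<alpha> \<in> M\<close> ch nz
  have near: "path \<beta> \<in> M \<and> chord \<beta> \<noteq> 0 \<and> \<beta> \<noteq> 0" if "\<bar>\<beta> - \<alpha>\<bar> < e" for \<beta>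
    using that by metis
  obtain \<beta>1 \<beta>2 where \<beta>: "\<beta>1 \<in> {\<alpha> - e<..<\<alpha> + e}" "\<beta>2 \<in> {\<alpha> - e<..<\<alpha> + e}"
    and ne: "\<beta>1 \<noteq> \<beta>2" and eq: "area_ratio \<beta>1 = area_ratio \<beta>2"
    using area_ratio_not_inj_near_critical_point[OF nz ch crit e] near by (force simp: inj_on_def)
  have exp_path: "std_exp (path \<beta>) = (w * chord \<alpha>, (norm (w * chord \<alpha>))\<^sup>2 * area_ratio \<beta>)"
    if "chord \<beta> \<noteq> 0" for \<beta>
    using that by (simp add: std_exp_def path_def area_ratio_def norm_divide power_divide)
  have "\<bar>\<beta>1 - \<alpha>\<bar> < e" "\<bar>\<beta>2 - \<alpha>\<bar> < e" using \<beta> by auto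
  then have "path \<beta>1 \<in> M" "path \<beta>2 \<in> M" "std_exp (path \<beta>1) = std_exp (path \<beta>2)"
    using near exp_path eq by auto
  moreover have "path \<beta>1 \<noteq> path \<beta>2" using ne by (simp add: path_def)
  ultimately show ?thesis by (auto simp: inj_on_def)
qed

section \<open>Reduction to the identity\<close>

lemma left_translate_has_derivative:
  "(left_translate (x, y, \<tau>) has_derivative
     (\<lambda>h. (Re (fst h), Im (fst h), (x * Im (fst h) - y * Re (fst h)) / 2 + snd h))) (at z)"
proof -
  have "left_translate (x, y, \<tau>) =
      (\<lambda>h. (x + Re (fst h), y + Im (fst h), \<tau> + (x * Im (fst h) - y * Re (fst h)) / 2 + snd h))"
    by (auto simp: left_translate_def)
  then show ?thesis by (auto intro!: derivative_eq_intros)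
qed

lemma bij_left_momentum: "bij (left_momentum q)"
proof (rule o_bij)
  let ?inv = "\<lambda>(w, \<alpha>). (Re w + \<alpha> * fst (snd q) / 2, Im w - \<alpha> * fst q / 2, \<alpha>)"
  show "?inv \<circ> left_momentum q = id" "left_momentum q \<circ> ?inv = id"
    by (auto simp: left_momentum_def fun_eq_iff complex_eq_iff split: prod.splits)
qed

lemma bounded_linear_left_momentum: "bounded_linear (left_momentum q)"
proof -
  have "linear (left_momentum q)"
    by (rule linearI)
       (auto simp: left_momentum_def complex_eq_iff algebra_simps add_divide_distrib split: prod.splits)
  then show ?thesis by (rule linear_conv_bounded_linear[THEN iffD1])
qed

lemma open_left_momentum_image:
  assumes "open U" shows "open (left_momentum q ` U)"
  using assms bounded_linear_left_momentum bij_left_momentum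
  by (intro open_surjective_linear_image) (auto simp: bij_def bounded_linear.linear)

text \<open>
  The differential of \<open>left_translate\<close> is injective and \<open>left_momentum\<close> is a linear isomorphism, so a
  kernel vector of the differential of \<open>sR_exp q\<close> at \<open>p\<close> yields one for \<open>std_exp\<close> at \<open>left_momentum q p\<close>.
  The open set \<open>U\<close> makes the closed form of \<open>sR_exp\<close> available on a neighbourhood.
\<close>
lemma conjugate_vector_imp_critical_std_exp:
  assumes U: "open U" "p \<in> U" "U \<subseteq> exp_domain q" and conj: "conjugate_vector q p"
    and mom: "left_momentum q p = (w, \<alpha>)"
    and c: "(chord has_vector_derivative c) (at \<alpha>)" and a: "(area has_real_derivative a) (at \<alpha>)"
  obtains dw d\<alpha> where "(dw, d\<alpha>) \<noteq> 0" "dw * chord \<alpha> + w * (d\<alpha> *\<^sub>R c) = 0"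
    "2 * (w \<bullet> dw) * area \<alpha> + (norm w)\<^sup>2 * (d\<alpha> * a) = 0"
proof -
  obtain x y \<tau> where q: "q = (x, y, \<tau>)" by (metis surj_pair)
  define T where "T h = (Re (fst h), Im (fst h), (x * Im (fst h) - y * Re (fst h)) / 2 + snd h)"
    for h :: "complex \<times> real"
  define E where "E h = (fst h * chord \<alpha> + w * (snd h *\<^sub>R c),
           2 * (w \<bullet> fst h) * area \<alpha> + (norm w)\<^sup>2 * (snd h * a))" for h :: "complex \<times> real"
  interpret L: bounded_linear "left_momentum q" by (rule bounded_linear_left_momentum)
  have "((\<lambda>p. std_exp (left_momentum q p)) has_derivative (\<lambda>v. E (left_momentum q v))) (at p)"
    using std_exp_has_derivative[OF c a, of w, folded E_def]
    by (intro has_derivative_compose[OF bounded_linear_imp_has_derivative[OF bounded_linear_left_momentum]])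
       (simp add: mom)
  then have "((\<lambda>p. left_translate q (std_exp (left_momentum q p))) has_derivative
      (\<lambda>v. T (E (left_momentum q v)))) (at p)"
    using left_translate_has_derivative[of x y \<tau>, folded T_def] unfolding q
    by (rule has_derivative_compose)
  then have "(sR_exp q has_derivative (\<lambda>v. T (E (left_momentum q v)))) (at p)"
    by (rule has_derivative_transform_within_open[OF _ U(1,2)])
       (use U(3) in \<open>auto simp: sR_exp_eq_std_exp\<close>)
  then have D: "frechet_derivative (sR_exp q) (at p) = (\<lambda>v. T (E (left_momentum q v)))"
    by (rule frechet_derivative_at[symmetric])
  have "T (E (left_momentum q 0)) = 0" unfolding L.zero by (simp add: T_def E_def zero_prod_def)
  then obtain v where v: "v \<noteq> 0" "T (E (left_momentum q v)) = 0"
    using conj unfolding conjugate_vector_def D by blast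
  obtain dw d\<alpha> where h: "left_momentum q v = (dw, d\<alpha>)" by (metis surj_pair)
  have "(dw, d\<alpha>) \<noteq> 0"
    using v(1) bij_left_momentum[of q] L.zero unfolding h[symmetric] by (metis bij_pointE)
  moreover have "E (dw, d\<alpha>) = 0"
    using v(2) unfolding h by (auto simp: T_def zero_prod_def complex_eq_iff prod_eq_iff)
  ultimately show thesis by (intro that) (auto simp: E_def zero_prod_def)
qed

text \<open>
  The Hamiltonian at \<open>p0\<close> is \<open>(norm w)\<^sup>2 / 2\<close>, so the assumption on it says \<open>w \<noteq> 0\<close>. Injectivity passes
  from \<open>sR_exp q\<close> on \<open>U\<close> to \<open>std_exp\<close> on the open image of \<open>U\<close>, where the dichotomy on \<open>chord \<alpha>\<close> refutes it.
\<close>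
theorem theorem2:
  fixes q :: heis and p0 :: covec
  assumes "p0 \<in> exp_domain q - hamiltonian_at q -` {0}"
    and "conjugate_vector q p0"
  shows "\<forall>N. N \<subseteq> exp_domain q \<and> p0 \<in> interior N \<longrightarrow> \<not> inj_on (sR_exp q) N"
proof (intro allI impI notI)
  fix N assume N: "N \<subseteq> exp_domain q \<and> p0 \<in> interior N" and inj: "inj_on (sR_exp q) N"
  define U where "U = interior N"
  have U: "open U" "p0 \<in> U" "U \<subseteq> exp_domain q" and UN: "U \<subseteq> N"
    using N interior_subset[of N] by (auto simp: U_def)
  obtain w \<alpha> where mom: "left_momentum q p0 = (w, \<alpha>)" by (metis surj_pair)
  have "hamiltonian_at q p0 = (norm w)\<^sup>2 / 2"
    using mom by (auto simp: hamiltonian_at_def hamiltonian_coords left_momentum_def cmod_power2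
        split: prod.splits)
  then have w: "w \<noteq> 0" using assms(1) by auto
  let ?M = "left_momentum q ` U"
  have M: "open ?M" "(w, \<alpha>) \<in> ?M"
    using open_left_momentum_image U mom by (auto simp: image_iff intro: bexI[of _ p0])
  have "\<not> inj_on std_exp ?M"
  proof (cases "chord \<alpha> = 0")
    case True
    then show ?thesis using std_exp_not_inj_if_chord_0 M w by blast
  next
    case False
    obtain c a where ca: "(chord has_vector_derivative c) (at \<alpha>)" "(area has_real_derivative a) (at \<alpha>)"
      using chord_differentiable area_differentiable by blast
    obtain dw d\<alpha> where ker: "(dw, d\<alpha>) \<noteq> 0" "dw * chord \<alpha> + w * (d\<alpha> *\<^sub>R c) = 0"
      "2 * (w \<bullet> dw) * area \<alpha> + (norm w)\<^sup>2 * (d\<alpha> * a) = 0"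
      using conjugate_vector_imp_critical_std_exp[OF U assms(2) mom ca] .
    show ?thesis
      using std_exp_not_inj_if_critical_area_ratio[OF M w False]
        critical_std_exp_imp_critical_area_ratio[OF ca w False ker] by blast
  qed
  moreover have "inj_on std_exp ?M"
  proof (intro inj_onI, elim imageE)
    fix m1 m2 p1 p2
    assume "std_exp m1 = std_exp m2" "m1 = left_momentum q p1" "m2 = left_momentum q p2"
      and p: "p1 \<in> U" "p2 \<in> U"
    moreover have "p1 \<in> exp_domain q" "p2 \<in> exp_domain q" using U(3) p by auto
    ultimately have "sR_exp q p1 = sR_exp q p2" by (simp add: sR_exp_eq_std_exp)
    then show "m1 = m2"
      using inj p UN \<open>m1 = _\<close> \<open>m2 = _\<close> by (auto dest: inj_onD)
  qed
  ultimately show False by blast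
qed

end
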